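(* Let $g,n\ge0$ be integers with $2g-2+n\ge1$. Then the topological space $M_{g,n}^{\rm trop}$ has pure dimension equal to $3g-3+n$.
   Context: Graphs. A graph $\Gamma$ with $n$ legs consists of a finite nonempty set $V(\Gamma)$ of vertices, a finite set $H(\Gamma)$ of half-edges, an involution $h\mapsto\overline h$ of $H(\Gamma)$ with exactly $n$ fixed points (the legs, which are labeled $x_1,\dots,x_n$), and an endpoint map $\epsilon:H(\Gamma)\to V(\Gamma)$. An edge is a pair $\{h,\overline h\}$ with $h\neq\overline h$; $E(\Gamma)$ is the set of edges. All graphs are connected. The valence of $v$ is $|\epsilon^{-1}(v)|$; $\Gamma$ is 3-regular if all vertices have valence 3. $b_1(\Gamma)=|E(\Gamma)|-|V(\Gamma)|+1$. Weighted graphs. A weighted graph is a pair $(\Gamma,w)$ with $w:V(\Gamma)\to\mathbb Z_{\ge 0}$; its genus is $b_1(\Gamma)+\sum_v w(v)$. $\underline 0$ is the zero weight function. For $S\subset E(\Gamma)$, the weighted contraction $(\Gamma_{/S},w_{/S})$ is obtained by contracting every edge of $S$ (with contraction map $\sigma:\Gamma\to\Gamma_{/S}$, so $E(\Gamma_{/S})=E(\Gamma)\smallsetminus S$ and the legs are unchanged) and setting $w_{/S}(\overline v)=b_1(\sigma^{-1}(\overline v))+\sum_{v\in V(\Gamma),\,\sigma(v)=\overline v}w(v)$. Moduli space. For a 3-regular graph $\Gamma$ with $b_1(\Gamma)=g$ and $n$ labeled legs, a point $p=(t_e)\in\overline{R(\Gamma,\underline 0)}:=\mathbb R_{\ge0}^{E(\Gamma)}$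 (euclidean topology) determines the metric weighted graph $(\Gamma_{/S},\underline0_{/S},\ell_p)$ with $S=\{e:t_e=0\}$ and $\ell_p(e)=t_e$ for $e\notin S$. $M_{g,n}^{\rm trop}$ is the quotient space of $\bigsqcup_\Gamma\overline{R(\Gamma,\underline0)}$ ($\Gamma$ running over isomorphism classes of such 3-regular graphs) in which two points are identified if the corresponding metric weighted graphs are isomorphic (by a graph isomorphism preserving weights, lengths and leg labels). Dimension. A topological space has pure dimension $d$ if it contains a dense open subset which is an orbifold of dimension $d$ (locally the quotient of a $d$-dimensional topological manifold by a finite group). *)

theory Defs
  imports "HOL-Analysis.Analysis" "HOL-Algebra.Group_Action"
begin

subsection \<open>Graphs with legs\<close>

record ('v, 'h) graph =
  verts :: "'v set"
  halves :: "'h set"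
  opp :: "'h \<Rightarrow> 'h"
  root :: "'h \<Rightarrow> 'v"
  label :: "'h \<Rightarrow> nat"  \<comment> \<open>a leg with label \<open>i\<close> is the leg \<open>x\<^sub>i\<close>; irrelevant off the legs\<close>

definition legs :: "('v, 'h) graph \<Rightarrow> 'h set" where
  "legs G = {h \<in> halves G. opp G h = h}"

definition edges :: "('v, 'h) graph \<Rightarrow> 'h set set" where
  "edges G = {{h, opp G h} | h. h \<in> halves G \<and> opp G h \<noteq> h}"

definition adjacent :: "('v, 'h) graph \<Rightarrow> 'h set set \<Rightarrow> ('v \<times> 'v) set" where
  "adjacent G S = {(root G h, root G (opp G h)) | h. h \<in> \<Union>S}"

definition connected_graph :: "('v, 'h) graph \<Rightarrow> bool" where
  "connected_graph G \<longleftrightarrow> (\<forall>u\<in>verts G. \<forall>v\<in>verts G. (u, v) \<in> (adjacent G (edges G))\<^sup>*)"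

definition graph_with_legs :: "nat \<Rightarrow> ('v, 'h) graph \<Rightarrow> bool" where
  "graph_with_legs n G \<longleftrightarrow>
     finite (verts G) \<and> verts G \<noteq> {} \<and> finite (halves G) \<and>
     (\<forall>h\<in>halves G. opp G h \<in> halves G \<and> opp G (opp G h) = h \<and> root G h \<in> verts G) \<and>
     bij_betw (label G) (legs G) {1..n} \<and>
     connected_graph G"

definition valence :: "('v, 'h) graph \<Rightarrow> 'v \<Rightarrow> nat" where
  "valence G v = card {h \<in> halves G. root G h = v}"

definition regular3 :: "('v, 'h) graph \<Rightarrow> bool" where
  "regular3 G \<longleftrightarrow> (\<forall>v\<in>verts G. valence G v = 3)"

definition betti1 :: "('v, 'h) graph \<Rightarrow> int" where
  "betti1 G = int (card (edges G)) - int (card (verts G)) + 1"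

definition graph_iso_via ::
  "('v, 'h) graph \<Rightarrow> ('w, 'k) graph \<Rightarrow> ('v \<Rightarrow> 'w) \<Rightarrow> ('h \<Rightarrow> 'k) \<Rightarrow> bool" where
  "graph_iso_via G G' \<phi> \<psi> \<longleftrightarrow>
     bij_betw \<phi> (verts G) (verts G') \<and> bij_betw \<psi> (halves G) (halves G') \<and>
     (\<forall>h\<in>halves G. \<psi> (opp G h) = opp G' (\<psi> h) \<and> \<phi> (root G h) = root G' (\<psi> h)) \<and>
     (\<forall>h\<in>legs G. label G' (\<psi> h) = label G h)"

definition graph_iso :: "('v, 'h) graph \<Rightarrow> ('w, 'k) graph \<Rightarrow> bool" where
  "graph_iso G G' \<longleftrightarrow> (\<exists>\<phi> \<psi>. graph_iso_via G G' \<phi> \<psi>)"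


subsection \<open>Weighted graphs, contraction and metric weighted graphs\<close>

type_synonym ('v, 'h) wgraph = "('v, 'h) graph \<times> ('v \<Rightarrow> nat)"

text \<open>The contraction map on vertices; a vertex of the contracted graph is a connected
  component of the subgraph with all vertices and the edges in \<open>S\<close>.\<close>

definition contract_map :: "('v, 'h) graph \<Rightarrow> 'h set set \<Rightarrow> 'v \<Rightarrow> 'v set" where
  "contract_map G S v = (adjacent G S)\<^sup>* `` {v}"

definition contract_graph :: "('v, 'h) graph \<Rightarrow> 'h set set \<Rightarrow> ('v set, 'h) graph" where
  "contract_graph G S =
     \<lparr>verts = contract_map G S ` verts G, halves = halves G - \<Union>S, opp = opp G,
      root = contract_map G S \<circ> root G, label = label G\<rparr>"

text \<open>The preimage of a vertex under the contraction: only contracted edges map to a vertex, so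
  uncontracted edges and legs do not belong to it.\<close>

definition contract_fibre :: "('v, 'h) graph \<Rightarrow> 'h set set \<Rightarrow> 'v set \<Rightarrow> ('v, 'h) graph" where
  "contract_fibre G S C =
     \<lparr>verts = {v \<in> verts G. contract_map G S v = C},
      halves = {h \<in> \<Union>S. contract_map G S (root G h) = C},
      opp = opp G, root = root G, label = label G\<rparr>"

text \<open>The fibres are connected, so \<^const>\<open>betti1\<close> is nonnegative on them and \<^const>\<open>nat\<close> does
  not truncate.\<close>

definition contract_weight :: "('v, 'h) wgraph \<Rightarrow> 'h set set \<Rightarrow> 'v set \<Rightarrow> nat" where
  "contract_weight = (\<lambda>(G, w) S C.
     nat (betti1 (contract_fibre G S C)) + (\<Sum>v | v \<in> verts G \<and> contract_map G S v = C. w v))"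

definition contract :: "('v, 'h) wgraph \<Rightarrow> 'h set set \<Rightarrow> ('v set, 'h) wgraph" where
  "contract = (\<lambda>(G, w) S. (contract_graph G S, contract_weight (G, w) S))"

type_synonym ('v, 'h) metric_wgraph = "('v, 'h) wgraph \<times> ('h set \<Rightarrow> real)"

definition metric_wgraph_iso ::
  "('v, 'h) metric_wgraph \<Rightarrow> ('w, 'k) metric_wgraph \<Rightarrow> bool" where
  "metric_wgraph_iso = (\<lambda>((G, w), l) ((G', w'), l').
     \<exists>\<phi> \<psi>. graph_iso_via G G' \<phi> \<psi> \<and> (\<forall>v\<in>verts G. w' (\<phi> v) = w v) \<and>
           (\<forall>e\<in>edges G. l' (\<psi> ` e) = l e))"

definition metric_wgraph_of ::
  "('v, 'h) graph \<times> ('h set \<Rightarrow> real) \<Rightarrow> ('v set, 'h) metric_wgraph" where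
  "metric_wgraph_of = (\<lambda>(G, t). (contract (G, \<lambda>_. 0) {e \<in> edges G. t e = 0}, t))"


subsection \<open>Quotient spaces\<close>

definition quotient_topology :: "'a topology \<Rightarrow> ('a \<Rightarrow> 'b) \<Rightarrow> 'b topology" where
  "quotient_topology X f =
     topology (\<lambda>U. U \<subseteq> f ` topspace X \<and> openin X {x \<in> topspace X. f x \<in> U})"

lemma openin_quotient_topology:
  "openin (quotient_topology X f) U \<longleftrightarrow>
     U \<subseteq> f ` topspace X \<and> openin X {x \<in> topspace X. f x \<in> U}"
proof -
  have "istopology (\<lambda>U. U \<subseteq> f ` topspace X \<and> openin X {x \<in> topspace X. f x \<in> U})"
    unfolding istopology_def
  proof (intro conjI allI impI)
    fix S T
    assume "S \<subseteq> f ` topspace X \<and> openin X {x \<in> topspace X. f x \<in> S}"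
      and "T \<subseteq> f ` topspace X \<and> openin X {x \<in> topspace X. f x \<in> T}"
    moreover have "{x \<in> topspace X. f x \<in> S \<inter> T} =
        {x \<in> topspace X. f x \<in> S} \<inter> {x \<in> topspace X. f x \<in> T}"
      by blast
    ultimately show "S \<inter> T \<subseteq> f ` topspace X"
      and "openin X {x \<in> topspace X. f x \<in> S \<inter> T}"
      by auto
  next
    fix K
    assume K: "\<forall>S\<in>K. S \<subseteq> f ` topspace X \<and> openin X {x \<in> topspace X. f x \<in> S}"
    then show "\<Union>K \<subseteq> f ` topspace X"
      by blast
    have "{x \<in> topspace X. f x \<in> \<Union>K} = (\<Union>S\<in>K. {x \<in> topspace X. f x \<in> S})"
      by blast
    then show "openin X {x \<in> topspace X. f x \<in> \<Union>K}"
      using K by auto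
  qed
  then show ?thesis
    unfolding quotient_topology_def by simp
qed

lemma topspace_quotient_topology [simp]:
  "topspace (quotient_topology X f) = f ` topspace X"
proof -
  have "{x \<in> topspace X. f x \<in> f ` topspace X} = topspace X"
    by blast
  then have "openin (quotient_topology X f) (f ` topspace X)"
    by (simp add: openin_quotient_topology)
  then have "f ` topspace X \<subseteq> topspace (quotient_topology X f)"
    by (rule openin_subset)
  moreover have "topspace (quotient_topology X f) \<subseteq> f ` topspace X"
    using openin_topspace [of "quotient_topology X f"] unfolding openin_quotient_topology
    by (rule conjunct1)
  ultimately show ?thesis
    by (rule subset_antisym [rotated])
qed

lemma quotient_map_quotient_topology: "quotient_map X (quotient_topology X f) f"
  unfolding quotient_map_def by (simp add: openin_quotient_topology)


subsection \<open>The tropical moduli space\<close>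

text \<open>Every finite graph is isomorphic to one whose vertices and half-edges are natural numbers.\<close>

definition cubic_graphs :: "nat \<Rightarrow> nat \<Rightarrow> (nat, nat) graph set" where
  "cubic_graphs g n = {G. graph_with_legs n G \<and> regular3 G \<and> betti1 G = int g}"

definition cubic_iso_rel :: "nat \<Rightarrow> nat \<Rightarrow> ((nat, nat) graph \<times> (nat, nat) graph) set" where
  "cubic_iso_rel g n = {(G, G') \<in> cubic_graphs g n \<times> cubic_graphs g n. graph_iso G G'}"

definition cubic_reps :: "nat \<Rightarrow> nat \<Rightarrow> (nat, nat) graph set" where
  "cubic_reps g n = (\<lambda>C. SOME G. G \<in> C) ` (cubic_graphs g n // cubic_iso_rel g n)"

definition closed_cell :: "('v, 'h) graph \<Rightarrow> ('h set \<Rightarrow> real) topology" where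
  "closed_cell G = product_topology (\<lambda>_. top_of_set {0..}) (edges G)"

definition cells :: "nat \<Rightarrow> nat \<Rightarrow> ((nat, nat) graph \<times> (nat set \<Rightarrow> real)) topology" where
  "cells g n = sum_topology closed_cell (cubic_reps g n)"

definition M_trop :: "nat \<Rightarrow> nat \<Rightarrow> ((nat, nat) graph \<times> (nat set \<Rightarrow> real)) set topology" where
  "M_trop g n = quotient_topology (cells g n)
     (\<lambda>p. {q \<in> topspace (cells g n). metric_wgraph_iso (metric_wgraph_of p) (metric_wgraph_of q)})"


subsection \<open>Orbifolds and pure dimension\<close>

definition topological_manifold :: "nat \<Rightarrow> 'a topology \<Rightarrow> bool" where
  "topological_manifold d M \<longleftrightarrow>
     Hausdorff_space M \<and> second_countable M \<and>
     (\<forall>x\<in>topspace M. \<exists>U V. openin M U \<and> x \<in> U \<and> openin (Euclidean_space d) V \<and>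
        subtopology M U homeomorphic_space subtopology (Euclidean_space d) V)"

text \<open>A second countable Hausdorff space has at most the cardinality of the continuum, so up to
  homeomorphism every manifold is a topology on a subset of \<^typ>\<open>nat \<Rightarrow> real\<close> (the topology being
  arbitrary); likewise every finite group is isomorphic to one carried by natural numbers.\<close>

definition orbifold :: "nat \<Rightarrow> 'a topology \<Rightarrow> bool" where
  "orbifold d X \<longleftrightarrow>
     (\<forall>x\<in>topspace X. \<exists>U. openin X U \<and> x \<in> U \<and>
        (\<exists>(M :: (nat \<Rightarrow> real) topology) (G :: nat monoid) \<alpha>.
           topological_manifold d M \<and>
           finite (carrier G) \<and> group_action G (topspace M) \<alpha> \<and>
           (\<forall>a\<in>carrier G. homeomorphic_map M M (\<alpha> a)) \<and>
           subtopology X U homeomorphic_space quotient_topology M (orbit G \<alpha>)))"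

definition has_pure_dimension :: "'a topology \<Rightarrow> nat \<Rightarrow> bool" where
  "has_pure_dimension X d \<longleftrightarrow>
     (\<exists>U. openin X U \<and> X closure_of U = topspace X \<and> orbifold d (subtopology X U))"

end

theory Submission
  imports Defs
begin

text \<open>
  A cubic graph of type \<open>(g, n)\<close> has exactly \<open>3 g - 3 + n\<close> edges, so a point of the moduli space with
  all edge lengths positive keeps all its edges, and it is isomorphic only to points of the open
  cell of the same graph.  Hence the images of the open cells are disjoint open sets; their union is
  dense because every edge length can be perturbed to a positive one.  The image of the open cell of
  \<open>G\<close> is the quotient of an open orthant by the edge permutations that automorphisms of \<open>G\<close> induce.
\<close>

section \<open>Quotients and finite group actions\<close>

text \<open>The edge count comes from counting half-edges twice: 3 V = n + 2 E by valence on one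
  side and by legs and edges on the other, together with E - V + 1 = g. That it is the same for all
  graphs is what makes the open cells saturated: contracting an edge lowers the number of edges, so
  a point with a zero length is never identified with a point without one. Two mismatches of
  encoding shape the charts. Points of a cell are functions on edges, undefined elsewhere, while a
  chart must live on \<open>nat \<Rightarrow> real\<close>, so the edges are enumerated. The group
  of a chart must be finite and carried by \<open>nat\<close>, but the pairs of maps in
  \<open>graph_iso_via\<close> are unconstrained off the graph, so they are replaced by the
  permutations of edge indices that they induce. The homeomorphism from the image of an open cell to
  the orbit space is never written down: the orthant maps onto both by quotient maps with the same
  fibres.\<close>

lemma quotient_maps_same_kernel_homeomorphic_space:
  assumes f: "quotient_map X Y f" and g: "quotient_map X Z g"
    and eq: "\<And>x y. \<lbrakk>x \<in> topspace X; y \<in> topspace X\<rbrakk> \<Longrightarrow> f x = f y \<longleftrightarrow> g x = g y"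
  shows "Y homeomorphic_space Z"
proof -
  \<comment> \<open>Equal fibres let each map factor through the other; the two factors are mutually
    inverse because \<open>f\<close> and \<open>g\<close> are onto.\<close>
  obtain a where a: "continuous_map Y Z a" "\<And>x. x \<in> topspace X \<Longrightarrow> a (f x) = g x"
    using quotient_map_lift_exists [OF f quotient_imp_continuous_map [OF g]] eq by metis
  obtain b where b: "continuous_map Z Y b" "\<And>x. x \<in> topspace X \<Longrightarrow> b (g x) = f x"
    using quotient_map_lift_exists [OF g quotient_imp_continuous_map [OF f]] eq by metis
  have "f ` topspace X = topspace Y" "g ` topspace X = topspace Z"
    using f g by (auto simp: quotient_map_def)
  then have "homeomorphic_maps Y Z a b"
    unfolding homeomorphic_maps_def using a b by (metis imageE)
  then show ?thesis
    unfolding homeomorphic_space_def by blast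
qed

text \<open>Brings a finite group of bijections into the shape that \<open>orbifold\<close> asks
  for, a group with carrier in \<open>nat\<close>. Any enumeration \<alpha> of \<open>H\<close> is
  itself the action once the multiplication of \<open>H\<close> is pulled back along it.\<close>

lemma finite_bijection_group_nat:
  assumes H: "subgroup H (BijGroup E)" and fin: "finite H"
  obtains G :: "nat monoid" and \<alpha>
  where "finite (carrier G)" "group_action G E \<alpha>" "\<alpha> ` carrier G = H"
proof -
  let ?B = "BijGroup E"
  interpret B: group ?B
    by (rule group_BijGroup)
  obtain \<alpha> where \<alpha>: "bij_betw \<alpha> {0..<card H} H"
    using ex_bij_betw_nat_finite [OF fin] by blast
  define \<beta> where "\<beta> = inv_into {0..<card H} \<alpha>"
  define G :: "nat monoid" where
    "G = \<lparr>carrier = {0..<card H}, mult = \<lambda>a b. \<beta> (\<alpha> a \<otimes>\<^bsub>?B\<^esub> \<alpha> b), one = \<beta> \<one>\<^bsub>?B\<^esub>\<rparr>"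
  have \<alpha>H: "\<alpha> a \<in> H" if "a < card H" for a
    using \<alpha> that by (auto simp: bij_betw_def)
  have HB: "h \<in> carrier ?B" if "h \<in> H" for h
    using subgroup.subset [OF H] that by blast
  have \<alpha>\<beta>: "\<alpha> (\<beta> h) = h" "\<beta> h < card H" if "h \<in> H" for h
    using \<alpha> that bij_betw_inv_into_right [OF \<alpha>] bij_betw_apply [OF bij_betw_inv_into [OF \<alpha>]]
    unfolding \<beta>_def by auto
  have \<beta>\<alpha>: "\<beta> (\<alpha> a) = a" if "a < card H" for a
    using bij_betw_inv_into_left [OF \<alpha>] that unfolding \<beta>_def by auto
  have mH: "g \<otimes>\<^bsub>?B\<^esub> h \<in> H" if "g \<in> H" "h \<in> H" for g h
    using that by (rule subgroup.m_closed [OF H])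
  have oH: "\<one>\<^bsub>?B\<^esub> \<in> H"
    by (rule subgroup.one_closed [OF H])
  have iH: "inv\<^bsub>?B\<^esub> h \<in> H" if "h \<in> H" for h
    using that by (rule subgroup.m_inv_closed [OF H])
  have "group G"
  proof (rule groupI)
    fix a assume "a \<in> carrier G"
    then have a: "a < card H" by (simp add: G_def)
    show "\<exists>b\<in>carrier G. b \<otimes>\<^bsub>G\<^esub> a = \<one>\<^bsub>G\<^esub>"
      using a by (intro bexI [of _ "\<beta> (inv\<^bsub>?B\<^esub> (\<alpha> a))"])
        (auto simp: G_def \<alpha>\<beta> iH \<alpha>H HB)
  qed (auto simp: G_def \<alpha>\<beta> \<beta>\<alpha> mH oH \<alpha>H HB B.m_assoc)
  moreover have "\<alpha> \<in> hom G ?B"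
    by (auto simp: hom_def G_def \<alpha>H HB \<alpha>\<beta> mH)
  ultimately have "group_action G E \<alpha>"
    unfolding group_action_def group_hom_def group_hom_axioms_def
    using group_BijGroup by blast
  moreover have "finite (carrier G)" "\<alpha> ` carrier G = H"
    using \<alpha> by (auto simp: G_def bij_betw_def)
  ultimately show ?thesis
    using that by blast
qed

section \<open>Isomorphisms of graphs\<close>

text \<open>The local axioms of a graph with legs, isolated because contractions inherit them
  directly, so that isomorphisms of contracted graphs can be inverted and composed by the same
  lemmas.\<close>

definition involutive_graph :: "('v, 'h) graph \<Rightarrow> bool" where
  "involutive_graph G \<longleftrightarrow>
     (\<forall>h\<in>halves G. opp G h \<in> halves G \<and> opp G (opp G h) = h \<and> root G h \<in> verts G)"

lemma involutive_graphD:
  assumes "involutive_graph G" "h \<in> halves G"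
  shows "opp G h \<in> halves G" "opp G (opp G h) = h" "root G h \<in> verts G"
  using assms by (auto simp: involutive_graph_def)

lemma graph_with_legs_imp_involutive: "graph_with_legs n G \<Longrightarrow> involutive_graph G"
  by (simp add: graph_with_legs_def involutive_graph_def)

lemma edges_subset_halves: "involutive_graph G \<Longrightarrow> e \<in> edges G \<Longrightarrow> e \<subseteq> halves G"
  by (auto simp: edges_def involutive_graph_def)

lemma edge_eq: "involutive_graph G \<Longrightarrow> e \<in> edges G \<Longrightarrow> h \<in> e \<Longrightarrow> e = {h, opp G h}"
  by (auto simp: edges_def involutive_graph_def)

lemma graph_iso_viaD:
  assumes "graph_iso_via G G' \<phi> \<psi>"
  shows "bij_betw \<phi> (verts G) (verts G')" "bij_betw \<psi> (halves G) (halves G')"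
    and "\<And>h. h \<in> halves G \<Longrightarrow> \<psi> (opp G h) = opp G' (\<psi> h)"
    and "\<And>h. h \<in> halves G \<Longrightarrow> \<phi> (root G h) = root G' (\<psi> h)"
    and "\<And>h. h \<in> legs G \<Longrightarrow> label G' (\<psi> h) = label G h"
  using assms by (auto simp: graph_iso_via_def)

lemma graph_iso_via_opp_eq_iff:
  assumes "graph_iso_via G G' \<phi> \<psi>" "involutive_graph G" "h \<in> halves G"
  shows "opp G' (\<psi> h) = \<psi> h \<longleftrightarrow> opp G h = h"
  using graph_iso_viaD [OF assms(1)] involutive_graphD [OF assms(2,3)] assms(3)
  by (metis bij_betw_inv_into_left)

lemma graph_iso_via_legs:
  assumes "graph_iso_via G G' \<phi> \<psi>" "involutive_graph G"
  shows "\<psi> ` legs G = legs G'"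
proof -
  have "\<psi> ` halves G = halves G'"
    using graph_iso_viaD(2) [OF assms(1)] by (simp add: bij_betw_def)
  then show ?thesis
    using graph_iso_via_opp_eq_iff [OF assms] by (fastforce simp: legs_def image_iff)
qed

text \<open>Compatibility with \<open>opp\<close> carries an edge to an edge. Both the transport of
  lengths and the comparison of edge counts rest on this.\<close>

lemma graph_iso_via_edges:
  assumes iso: "graph_iso_via G G' \<phi> \<psi>" and G: "involutive_graph G"
  shows "bij_betw ((`) \<psi>) (edges G) (edges G')"
  unfolding bij_betw_def
proof
  note b = graph_iso_viaD(2) [OF iso]
  show "inj_on ((`) \<psi>) (edges G)"
    using b edges_subset_halves [OF G] by (auto simp: bij_betw_def inj_on_def inj_on_image_eq_iff)
  have sur: "halves G' = \<psi> ` halves G"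
    using b by (simp add: bij_betw_def)
  show "(`) \<psi> ` edges G = edges G'"
  proof (intro equalityI subsetI)
    fix e' assume "e' \<in> (`) \<psi> ` edges G"
    then obtain h where h: "h \<in> halves G" "opp G h \<noteq> h" "e' = {\<psi> h, \<psi> (opp G h)}"
      by (auto simp: edges_def)
    then show "e' \<in> edges G'"
      using graph_iso_via_opp_eq_iff [OF iso G h(1)] graph_iso_viaD(3) [OF iso h(1)] sur
      unfolding edges_def by auto
  next
    fix e' assume "e' \<in> edges G'"
    then obtain h where h: "h \<in> halves G" "opp G' (\<psi> h) \<noteq> \<psi> h" "e' = {\<psi> h, opp G' (\<psi> h)}"
      by (auto simp: edges_def sur)
    then have "e' = \<psi> ` {h, opp G h}" "{h, opp G h} \<in> edges G"
      using graph_iso_via_opp_eq_iff [OF iso G h(1)] graph_iso_viaD(3) [OF iso h(1)]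
      unfolding edges_def by auto
    then show "e' \<in> (`) \<psi> ` edges G" by blast
  qed
qed

lemma graph_iso_via_id: "graph_iso_via G G id id"
  by (auto simp: graph_iso_via_def)

lemma graph_iso_via_comp:
  assumes "graph_iso_via G G' \<phi> \<psi>" "graph_iso_via G' G'' \<phi>' \<psi>'" "involutive_graph G"
  shows "graph_iso_via G G'' (\<phi>' \<circ> \<phi>) (\<psi>' \<circ> \<psi>)"
proof -
  note 1 = graph_iso_viaD [OF assms(1)] and 2 = graph_iso_viaD [OF assms(2)]
  have "\<psi> h \<in> halves G'" if "h \<in> halves G" for h
    using 1(2) that bij_betwE by blast
  moreover have "\<psi> h \<in> legs G'" if "h \<in> legs G" for h
    using graph_iso_via_legs [OF assms(1,3)] that by blast
  ultimately show ?thesis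
    unfolding graph_iso_via_def using 1 2 by (auto intro: bij_betw_trans)
qed

lemma graph_iso_via_inv:
  assumes iso: "graph_iso_via G G' \<phi> \<psi>" and G: "involutive_graph G"
  shows "graph_iso_via G' G (inv_into (verts G) \<phi>) (inv_into (halves G) \<psi>)"
proof -
  note 1 = graph_iso_viaD [OF iso] and 2 = involutive_graphD [OF G]
  have sur: "halves G' = \<psi> ` halves G"
    using 1(2) by (simp add: bij_betw_def)
  have inv: "inv_into (halves G) \<psi> (\<psi> h) = h" if "h \<in> halves G" for h
    using 1(2) that by (simp add: bij_betw_inv_into_left)
  have inv': "inv_into (verts G) \<phi> (\<phi> v) = v" if "v \<in> verts G" for v
    using 1(1) that by (simp add: bij_betw_inv_into_left)
  have "inv_into (halves G) \<psi> (opp G' h') = opp G (inv_into (halves G) \<psi> h') \<and>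
        inv_into (verts G) \<phi> (root G' h') = root G (inv_into (halves G) \<psi> h')"
    if "h' \<in> halves G'" for h'
    using that unfolding sur by (auto simp: inv inv' 2 simp flip: 1(3,4))
  moreover have "label G (inv_into (halves G) \<psi> h') = label G' h'" if "h' \<in> legs G'" for h'
  proof -
    obtain h where "h \<in> legs G" "h' = \<psi> h"
      using \<open>h' \<in> legs G'\<close> graph_iso_via_legs [OF iso G] by blast
    then show ?thesis
      using 1(5) inv by (simp add: legs_def)
  qed
  ultimately show ?thesis
    unfolding graph_iso_via_def using 1(1,2) by (simp add: bij_betw_inv_into)
qed

section \<open>Isomorphism of metric weighted graphs as an equivalence relation\<close>

lemma metric_wgraph_iso_refl: "metric_wgraph_iso ((G, w), l) ((G, w), l)"
  unfolding metric_wgraph_iso_def prod.case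
  by (rule exI [of _ id], rule exI [of _ id]) (simp add: graph_iso_via_id)

lemma metric_wgraph_iso_trans:
  assumes "metric_wgraph_iso ((G, w), l) ((G', w'), l')" "metric_wgraph_iso ((G', w'), l') ((G'', w''), l'')"
    and G: "involutive_graph G"
  shows "metric_wgraph_iso ((G, w), l) ((G'', w''), l'')"
proof -
  from assms(1) obtain \<phi> \<psi> where 1: "graph_iso_via G G' \<phi> \<psi>" "\<forall>v\<in>verts G. w' (\<phi> v) = w v"
    "\<forall>e\<in>edges G. l' (\<psi> ` e) = l e"
    by (auto simp: metric_wgraph_iso_def)
  from assms(2) obtain \<phi>' \<psi>' where 2: "graph_iso_via G' G'' \<phi>' \<psi>'" "\<forall>v\<in>verts G'. w'' (\<phi>' v) = w' v"
    "\<forall>e\<in>edges G'. l'' (\<psi>' ` e) = l' e"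
    by (auto simp: metric_wgraph_iso_def)
  have "\<phi> v \<in> verts G'" if "v \<in> verts G" for v
    using graph_iso_viaD(1) [OF 1(1)] that bij_betwE by blast
  moreover have "\<psi> ` e \<in> edges G'" if "e \<in> edges G" for e
    using graph_iso_via_edges [OF 1(1) G] that bij_betwE by blast
  ultimately have "(\<forall>v\<in>verts G. w'' ((\<phi>' \<circ> \<phi>) v) = w v) \<and> (\<forall>e\<in>edges G. l'' ((\<psi>' \<circ> \<psi>) ` e) = l e)"
    using 1 2 by (simp flip: image_image)
  then show ?thesis
    using graph_iso_via_comp [OF 1(1) 2(1) G] unfolding metric_wgraph_iso_def prod.case by blast
qed

lemma metric_wgraph_iso_sym:
  assumes "metric_wgraph_iso ((G, w), l) ((G', w'), l')" and G: "involutive_graph G"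
  shows "metric_wgraph_iso ((G', w'), l') ((G, w), l)"
proof -
  from assms(1) obtain \<phi> \<psi> where 1: "graph_iso_via G G' \<phi> \<psi>" "\<forall>v\<in>verts G. w' (\<phi> v) = w v"
    "\<forall>e\<in>edges G. l' (\<psi> ` e) = l e"
    by (auto simp: metric_wgraph_iso_def)
  note D = graph_iso_viaD [OF 1(1)]
  have "w (inv_into (verts G) \<phi> v') = w' v'" if "v' \<in> verts G'" for v'
    using 1(2) D(1) that by (metis bij_betw_imp_surj_on f_inv_into_f inv_into_into)
  moreover have "l (inv_into (halves G) \<psi> ` e') = l' e'" if e': "e' \<in> edges G'" for e'
  proof -
    obtain e where e: "e \<in> edges G" "e' = \<psi> ` e"
      using graph_iso_via_edges [OF 1(1) G] e' unfolding bij_betw_def by blast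
    have "inv_into (halves G) \<psi> ` \<psi> ` e = e"
      using D(2) edges_subset_halves [OF G e(1)] by (simp add: bij_betw_def)
    then show ?thesis
      using 1(3) e by simp
  qed
  ultimately show ?thesis
    using graph_iso_via_inv [OF 1(1) G] unfolding metric_wgraph_iso_def prod.case by blast
qed

section \<open>Contractions\<close>

text \<open>The deleted half-edges form a union of whole edges, so \<open>opp\<close> cannot lead
  from a remaining half-edge to a deleted one.\<close>

lemma involutive_contract_graph:
  assumes G: "involutive_graph G" and S: "S \<subseteq> edges G"
  shows "involutive_graph (contract_graph G S)"
proof -
  have "opp G h \<notin> \<Union>S" if h: "h \<in> halves G" "h \<notin> \<Union>S" for h
  proof
    assume "opp G h \<in> \<Union>S"
    then obtain e where e: "e \<in> S" "opp G h \<in> e"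
      by blast
    then have "e = {opp G h, opp G (opp G h)}"
      using edge_eq [OF G] S by blast
    then show False
      using h e involutive_graphD(2) [OF G h(1)] by auto
  qed
  then show ?thesis
    using involutive_graphD [OF G] by (auto simp: involutive_graph_def contract_graph_def)
qed

text \<open>An edge is determined by either of its half-edges, so deleting the half-edges of
  \<open>S\<close> destroys no edge outside \<open>S\<close>.\<close>

lemma edges_contract_graph:
  assumes G: "involutive_graph G" and S: "S \<subseteq> edges G"
  shows "edges (contract_graph G S) = edges G - S"
proof (intro equalityI subsetI)
  fix e assume "e \<in> edges (contract_graph G S)"
  then show "e \<in> edges G - S"
    by (auto simp: edges_def contract_graph_def)
next
  fix e assume e: "e \<in> edges G - S"
  then obtain h where h: "h \<in> halves G" "opp G h \<noteq> h" "e = {h, opp G h}"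
    by (auto simp: edges_def)
  have "h \<notin> \<Union>S"
  proof
    assume "h \<in> \<Union>S"
    then have "e \<in> S"
      using edge_eq [OF G] S h(3) by blast
    then show False
      using e by blast
  qed
  then show "e \<in> edges (contract_graph G S)"
    using h by (auto simp: edges_def contract_graph_def)
qed

lemma metric_wgraph_of_eq:
  "metric_wgraph_of (G, t) =
     ((contract_graph G {e \<in> edges G. t e = 0}, contract_weight (G, \<lambda>_. 0) {e \<in> edges G. t e = 0}), t)"
  by (simp add: metric_wgraph_of_def contract_def)

section \<open>Points without edges of length zero\<close>

lemma contract_map_empty [simp]: "contract_map G {} v = {v}"
  by (auto simp: contract_map_def adjacent_def)

text \<open>Even when nothing is contracted, the contracted graph differs from \<open>G\<close>: its
  vertices are singletons. So there is an isomorphism instead of an equality.\<close>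

lemma metric_wgraph_of_iso_uncontracted:
  assumes "\<And>e. e \<in> edges G \<Longrightarrow> t e \<noteq> 0"
  shows "metric_wgraph_iso ((G, \<lambda>_. 0), t) (metric_wgraph_of (G, t))"
proof -
  have S: "{e \<in> edges G. t e = 0} = {}"
    using assms by blast
  have "bij_betw (\<lambda>v. {v}) (verts G) ((\<lambda>v. {v}) ` verts G)"
    by (simp add: bij_betw_def)
  then have "graph_iso_via G (contract_graph G {}) (\<lambda>v. {v}) id"
    by (auto simp: graph_iso_via_def contract_graph_def)
  \<comment> \<open>The fibre over \<open>{v}\<close> has one vertex and no edges, so its first
    Betti number is 0 - 1 + 1 = 0.\<close>
  moreover have "contract_weight (G, \<lambda>_. 0) {} {v} = 0" if "v \<in> verts G" for v
  proof -
    have "{u \<in> verts G. u = v} = {v}"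
      using that by blast
    then show ?thesis
      by (simp add: contract_weight_def contract_fibre_def betti1_def edges_def)
  qed
  ultimately show ?thesis
    unfolding metric_wgraph_of_eq S metric_wgraph_iso_def prod.case
    by (intro exI [of _ "\<lambda>v. {v}"] exI [of _ id]) auto
qed

abbreviation same_point :: "('v, 'h) graph \<times> ('h set \<Rightarrow> real) \<Rightarrow> ('w, 'k) graph \<times> ('k set \<Rightarrow> real) \<Rightarrow> bool" where
  "same_point p q \<equiv> metric_wgraph_iso (metric_wgraph_of p) (metric_wgraph_of q)"

lemma same_point_refl: "same_point p p"
  by (cases p) (simp add: metric_wgraph_of_eq metric_wgraph_iso_refl)

lemma same_point_sym:
  assumes "same_point p q" "involutive_graph (fst p)"
  shows "same_point q p"
proof -
  have "involutive_graph (contract_graph (fst p) {e \<in> edges (fst p). snd p e = 0})"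
    using assms(2) by (simp add: involutive_contract_graph)
  then show ?thesis
    using assms(1) metric_wgraph_iso_sym
    by (cases p; cases q) (simp add: metric_wgraph_of_eq)
qed

lemma same_point_trans:
  assumes "same_point p q" "same_point q r" "involutive_graph (fst p)"
  shows "same_point p r"
proof -
  have "involutive_graph (contract_graph (fst p) {e \<in> edges (fst p). snd p e = 0})"
    using assms(3) by (simp add: involutive_contract_graph)
  then show ?thesis
    using assms(1,2) metric_wgraph_iso_trans
    by (cases p; cases q; cases r) (simp add: metric_wgraph_of_eq, blast)
qed

text \<open>Composing with the isomorphisms to the uncontracted graphs removes the contraction on
  both sides. All weights are then zero, and the lengths are the only condition left.\<close>

lemma same_point_nonzero_iff:
  assumes t: "\<And>e. e \<in> edges G \<Longrightarrow> t e \<noteq> 0" and t': "\<And>e. e \<in> edges G' \<Longrightarrow> t' e \<noteq> 0"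
    and G: "involutive_graph G" and G': "involutive_graph G'"
  shows "same_point (G, t) (G', t') \<longleftrightarrow> (\<exists>\<phi> \<psi>. graph_iso_via G G' \<phi> \<psi> \<and> (\<forall>e\<in>edges G. t' (\<psi> ` e) = t e))"
proof -
  have u: "metric_wgraph_iso ((G, \<lambda>_. 0), t) (metric_wgraph_of (G, t))"
    and u': "metric_wgraph_iso ((G', \<lambda>_. 0), t') (metric_wgraph_of (G', t'))"
    using t t' by (blast intro: metric_wgraph_of_iso_uncontracted)+
  note u = u [unfolded metric_wgraph_of_eq] and u' = u' [unfolded metric_wgraph_of_eq]
  have C: "involutive_graph (contract_graph G {e \<in> edges G. t e = 0})"
    using G by (simp add: involutive_contract_graph)
  have "same_point (G, t) (G', t') \<longleftrightarrow> metric_wgraph_iso ((G, \<lambda>_. 0), t) ((G', \<lambda>_. 0), t')"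
    unfolding metric_wgraph_of_eq
    using metric_wgraph_iso_trans [OF u metric_wgraph_iso_trans [OF _ metric_wgraph_iso_sym [OF u' G'] C] G]
      metric_wgraph_iso_trans [OF metric_wgraph_iso_sym [OF u G] metric_wgraph_iso_trans [OF _ u' G] C]
    by blast
  then show ?thesis
    by (simp add: metric_wgraph_iso_def)
qed

text \<open>The target keeps all its edges, while the source keeps only those outside
  \<open>S\<close>. An isomorphism matches the two numbers, and since the totals agree,
  \<open>S\<close> is empty.\<close>

lemma same_point_nonzero_transfer:
  assumes iso: "same_point (G, t) (G', t')" and t': "\<And>e. e \<in> edges G' \<Longrightarrow> t' e \<noteq> 0"
    and G: "involutive_graph G" and G': "involutive_graph G'"
    and fin: "finite (edges G)" and card: "card (edges G) = card (edges G')"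
    and e: "e \<in> edges G"
  shows "t e \<noteq> 0"
proof -
  define S where "S = {e \<in> edges G. t e = 0}"
  have S': "{e \<in> edges G'. t' e = 0} = {}"
    using t' by blast
  have sub: "S \<subseteq> edges G"
    by (auto simp: S_def)
  obtain \<phi> \<psi> where "graph_iso_via (contract_graph G S) (contract_graph G' {}) \<phi> \<psi>"
    using iso unfolding metric_wgraph_of_eq S' S_def [symmetric] metric_wgraph_iso_def by auto
  then have "card (edges G - S) = card (edges G' - {})"
    using graph_iso_via_edges [OF _ involutive_contract_graph [OF G sub]] bij_betw_same_card
      edges_contract_graph [OF G sub] edges_contract_graph [OF G', of "{}"] by fastforce
  then have "S = {}"
    using card fin sub by (metis Diff_empty card_subset_eq Diff_subset Diff_disjoint Int_absorb2 inf.commute)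
  then show ?thesis
    using e by (auto simp: S_def)
qed

section \<open>Counting edges\<close>

text \<open>The half-edges split into the fixed points of \<open>opp\<close>, which are the legs,
  and its orbits of size two, which are the edges; a loop too has two half-edges.\<close>

lemma card_halves:
  assumes fin: "finite (halves G)" and G: "involutive_graph G"
  shows "card (halves G) = card (legs G) + 2 * card (edges G)"
proof -
  have U: "halves G - legs G = \<Union>(edges G)"
  proof (intro equalityI subsetI)
    fix h assume "h \<in> halves G - legs G"
    then have "{h, opp G h} \<in> edges G"
      unfolding legs_def edges_def by blast
    then show "h \<in> \<Union>(edges G)"
      by blast
  next
    fix h assume "h \<in> \<Union>(edges G)"
    then obtain k where "k \<in> halves G" "opp G k \<noteq> k" "h = k \<or> h = opp G k"
      by (auto simp: edges_def)
    then show "h \<in> halves G - legs G"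
      using involutive_graphD(1,2) [OF G, of k] by (auto simp: legs_def)
  qed
  have "card (\<Union>(edges G)) = (\<Sum>e\<in>edges G. card e)"
  proof (rule card_Union_disjoint)
    show "disjoint (edges G)"
    proof (rule disjointI)
      fix a b assume "a \<in> edges G" "b \<in> edges G" "a \<noteq> b"
      then show "a \<inter> b = {}"
        using edge_eq [OF G] by blast
    qed
    show "finite e" if "e \<in> edges G" for e
      using that by (auto simp: edges_def)
  qed
  also have "\<dots> = (\<Sum>e\<in>edges G. 2)"
    by (rule sum.cong) (auto simp: edges_def)
  finally have "card (halves G - legs G) = 2 * card (edges G)"
    by (simp add: U)
  moreover have "card (halves G - legs G) = card (halves G) - card (legs G)" "card (legs G) \<le> card (halves G)"
    using fin by (auto simp: legs_def card_Diff_subset card_mono)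
  ultimately show ?thesis
    by linarith
qed

lemma card_halves_regular3:
  assumes "finite (halves G)" "finite (verts G)" "involutive_graph G" "regular3 G"
  shows "card (halves G) = 3 * card (verts G)"
proof -
  have "halves G = (\<Union>v\<in>verts G. {h \<in> halves G. root G h = v})"
    using involutive_graphD(3) [OF assms(3)] by blast
  then have "card (halves G) = card (\<Union>v\<in>verts G. {h \<in> halves G. root G h = v})"
    by simp
  also have "\<dots> = (\<Sum>v\<in>verts G. valence G v)"
    unfolding valence_def using assms by (intro card_UN_disjoint) auto
  also have "\<dots> = 3 * card (verts G)"
    using assms(4) by (simp add: regular3_def)
  finally show ?thesis .
qed

lemma cubic_graphsD:
  assumes "G \<in> cubic_graphs g n"
  shows "involutive_graph G" "finite (edges G)" "card (edges G) = nat (3 * int g - 3 + int n)"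
proof -
  have G: "graph_with_legs n G" "regular3 G" "betti1 G = int g"
    using assms by (auto simp: cubic_graphs_def)
  then have fin: "finite (halves G)" "finite (verts G)" and leg: "card (legs G) = n"
    using bij_betw_same_card by (fastforce simp: graph_with_legs_def)+
  show inv: "involutive_graph G"
    using G graph_with_legs_imp_involutive by blast
  show "finite (edges G)"
    unfolding edges_def using fin by simp
  \<comment> \<open>With V vertices and E edges, 3 V = n + 2 E and E - V + 1 = g give E = 3 g - 3 +
    n. In particular this integer is nonnegative here and \<open>nat\<close> does not truncate
    it.\<close>
  show "card (edges G) = nat (3 * int g - 3 + int n)"
    using G(3) card_halves [OF fin(1) inv] card_halves_regular3 [OF fin inv G(2)] leg
    by (simp add: betti1_def)
qed

section \<open>One representative for each isomorphism class\<close>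

lemma equiv_cubic_iso_rel: "equiv (cubic_graphs g n) (cubic_iso_rel g n)"
proof (rule equivI)
  show "cubic_iso_rel g n \<subseteq> cubic_graphs g n \<times> cubic_graphs g n"
    by (auto simp: cubic_iso_rel_def)
  show "refl_on (cubic_graphs g n) (cubic_iso_rel g n)"
    using graph_iso_via_id unfolding refl_on_def cubic_iso_rel_def graph_iso_def by blast
  show "sym (cubic_iso_rel g n)"
    unfolding sym_def cubic_iso_rel_def graph_iso_def
    using cubic_graphsD(1) graph_iso_via_inv by blast
  show "trans (cubic_iso_rel g n)"
    unfolding trans_def cubic_iso_rel_def graph_iso_def
    using cubic_graphsD(1) graph_iso_via_comp by blast
qed

lemma cubic_reps_in_class:
  assumes "C \<in> cubic_graphs g n // cubic_iso_rel g n"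
  shows "(SOME G. G \<in> C) \<in> C"
  using in_quotient_imp_non_empty [OF equiv_cubic_iso_rel assms] some_in_eq by blast

lemma cubic_reps_subset: "cubic_reps g n \<subseteq> cubic_graphs g n"
  unfolding cubic_reps_def
  using cubic_reps_in_class in_quotient_imp_subset [OF equiv_cubic_iso_rel] by blast

text \<open>Isomorphic representatives come from the same class, and the chosen element depends on
  the class alone.\<close>

lemma cubic_reps_iso_imp_eq:
  assumes "G \<in> cubic_reps g n" "G' \<in> cubic_reps g n" "graph_iso G G'"
  shows "G = G'"
proof -
  obtain C C' where C: "C \<in> cubic_graphs g n // cubic_iso_rel g n" "G = (SOME G. G \<in> C)"
    "C' \<in> cubic_graphs g n // cubic_iso_rel g n" "G' = (SOME G. G \<in> C')"
    using assms by (auto simp: cubic_reps_def)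
  have "(G, G') \<in> cubic_iso_rel g n"
    using assms cubic_reps_subset by (auto simp: cubic_iso_rel_def)
  then have "C = C'"
    using quotient_eq_iff [OF equiv_cubic_iso_rel C(1,3)] cubic_reps_in_class C by blast
  then show ?thesis
    using C by simp
qed

section \<open>The cells of the moduli space\<close>

lemma cubic_repsD:
  assumes "G \<in> cubic_reps g n"
  shows "involutive_graph G" "finite (edges G)" "card (edges G) = nat (3 * int g - 3 + int n)"
  using assms cubic_reps_subset cubic_graphsD by blast+

text \<open>\<open>PiE\<close> fixes the value off the edges to \<open>undefined\<close>, as for all
  points of \<open>closed_cell\<close>.\<close>

definition open_cell :: "('v, 'h) graph \<Rightarrow> ('h set \<Rightarrow> real) set" where
  "open_cell G = (\<Pi>\<^sub>E e\<in>edges G. {0<..})"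

definition trop_class ::
  "nat \<Rightarrow> nat \<Rightarrow> (nat, nat) graph \<times> (nat set \<Rightarrow> real) \<Rightarrow> ((nat, nat) graph \<times> (nat set \<Rightarrow> real)) set" where
  "trop_class g n p = {q \<in> topspace (cells g n). same_point p q}"

lemma M_trop_eq: "M_trop g n = quotient_topology (cells g n) (trop_class g n)"
  unfolding M_trop_def trop_class_def [abs_def] ..

lemma mem_topspace_cells:
  "(G, t) \<in> topspace (cells g n) \<longleftrightarrow> G \<in> cubic_reps g n \<and> t \<in> (\<Pi>\<^sub>E e\<in>edges G. {0..})"
  by (simp add: cells_def closed_cell_def)

lemma topspace_closed_cell: "topspace (closed_cell G) = (\<Pi>\<^sub>E e\<in>edges G. {0..})"
  by (simp add: closed_cell_def)

lemma open_cell_subset: "open_cell G \<subseteq> topspace (closed_cell G)"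
  unfolding open_cell_def topspace_closed_cell by (rule PiE_mono) auto

lemma open_cell_pos: "t \<in> open_cell G \<Longrightarrow> e \<in> edges G \<Longrightarrow> 0 < t e"
  unfolding open_cell_def using PiE_mem by fastforce

lemma trop_class_eq_iff:
  assumes p: "p \<in> topspace (cells g n)" and q: "q \<in> topspace (cells g n)"
  shows "trop_class g n p = trop_class g n q \<longleftrightarrow> same_point p q"
proof
  assume "trop_class g n p = trop_class g n q"
  then show "same_point p q"
    using q same_point_refl [of q] unfolding trop_class_def by blast
next
  assume pq: "same_point p q"
  have G: "involutive_graph (fst p)" "involutive_graph (fst q)"
    using p q cubic_repsD(1) by (metis mem_topspace_cells prod.collapse)+
  show "trop_class g n p = trop_class g n q"
    unfolding trop_class_def
    using same_point_trans [OF pq _ G(1)] same_point_trans [OF same_point_sym [OF pq G(1)] _ G(2)]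
    by blast
qed

text \<open>Edge counts exclude zero lengths in \<open>p\<close>; then its graph is isomorphic to
  \<open>G\<close> and hence the same representative. This saturation of the open cell makes its
  image open and allows the quotient map to be restricted to it.\<close>

lemma trop_class_mem_open_cell:
  assumes p: "p \<in> topspace (cells g n)" and G: "G \<in> cubic_reps g n"
  shows "trop_class g n p \<in> trop_class g n ` ({G} \<times> open_cell G) \<longleftrightarrow> p \<in> {G} \<times> open_cell G"
proof
  assume "trop_class g n p \<in> trop_class g n ` ({G} \<times> open_cell G)"
  then obtain t where t: "t \<in> open_cell G" "trop_class g n p = trop_class g n (G, t)"
    by blast
  obtain G' t' where p': "p = (G', t')"
    by (cases p)
  have G': "G' \<in> cubic_reps g n" "t' \<in> (\<Pi>\<^sub>E e\<in>edges G'. {0..})"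
    using p by (auto simp: p' mem_topspace_cells)
  have "(G, t) \<in> topspace (cells g n)"
    using G t(1) open_cell_subset by (auto simp: mem_topspace_cells topspace_closed_cell)
  then have iso: "same_point (G', t') (G, t)"
    using t(2) trop_class_eq_iff p p' by blast
  have nz: "t e \<noteq> 0" if "e \<in> edges G" for e
    using open_cell_pos [OF t(1) that] by simp
  have nz': "t' e \<noteq> 0" if "e \<in> edges G'" for e
    using same_point_nonzero_transfer [OF iso nz _ _ _ _ that] cubic_repsD [OF G] cubic_repsD [OF G'(1)]
    by simp
  then have "\<exists>\<phi> \<psi>. graph_iso_via G' G \<phi> \<psi>"
    using iso same_point_nonzero_iff [of G' t' G t] nz cubic_repsD(1) [OF G] cubic_repsD(1) [OF G'(1)]
    by blast
  then have "G' = G"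
    using cubic_reps_iso_imp_eq [OF G'(1) G] unfolding graph_iso_def by blast
  moreover have "t' \<in> open_cell G'"
    unfolding open_cell_def
  proof (rule PiE_I)
    show "t' e \<in> {0<..}" if "e \<in> edges G'" for e
      using PiE_mem [OF G'(2) that] nz' [OF that] by auto
    show "t' e = undefined" if "e \<notin> edges G'" for e
      using PiE_arb [OF G'(2) that] .
  qed
  ultimately show "p \<in> {G} \<times> open_cell G"
    by (simp add: p')
qed blast

lemma openin_open_cell:
  assumes "finite (edges G)"
  shows "openin (closed_cell G) (open_cell G)"
proof -
  have "openin (top_of_set {0::real..}) {0<..}"
    by (auto simp: openin_open intro!: exI [of _ "{0<..}"])
  then show ?thesis
    unfolding closed_cell_def open_cell_def using assms by (simp add: openin_PiE_gen)
qed

text \<open>Closure commutes with products, so the claim reduces to one coordinate, where 0 is a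
  limit of positive numbers.\<close>

lemma closure_of_open_cell: "closed_cell G closure_of open_cell G = topspace (closed_cell G)"
proof -
  have "top_of_set {0..} closure_of {0<..} = {0::real..}"
  proof -
    have "{0::real<..} \<subseteq> {0..}"
      by auto
    then show ?thesis
      by (simp add: closure_of_subtopology_open)
  qed
  then show ?thesis
    unfolding closed_cell_def open_cell_def by (simp add: closure_of_product_topology)
qed

lemma openin_cells_open_cell:
  assumes "G \<in> cubic_reps g n"
  shows "openin (cells g n) ({G} \<times> open_cell G)"
proof -
  have "openin (cells g n) (Pair G ` open_cell G)"
    using open_map_component_injection [OF assms, of closed_cell] openin_open_cell [OF cubic_repsD(2) [OF assms]]
    unfolding cells_def open_map_def by blast
  moreover have "{G} \<times> open_cell G = Pair G ` open_cell G"
    by auto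
  ultimately show ?thesis
    by simp
qed

section \<open>Openness and density of the images of the open cells\<close>

lemma openin_M_trop_open_cell:
  assumes "G \<in> cubic_reps g n"
  shows "openin (M_trop g n) (trop_class g n ` ({G} \<times> open_cell G))"
    (is "openin _ (_ ` ?W)")
proof -
  have W: "openin (cells g n) ?W"
    using assms by (rule openin_cells_open_cell)
  moreover have "{p \<in> topspace (cells g n). trop_class g n p \<in> trop_class g n ` ?W} = ?W"
    using trop_class_mem_open_cell [OF _ assms] openin_subset [OF W] by blast
  ultimately show ?thesis
    unfolding M_trop_eq openin_quotient_topology using openin_subset [OF W] by (simp add: image_mono)
qed

text \<open>No perturbation is chosen explicitly: the continuous map from a closed cell to the
  quotient sends the closure of the open cell, which is the whole closed cell, into the closure of
  the union.\<close>

lemma M_trop_closure_of_open_cells: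
  "M_trop g n closure_of (\<Union>G\<in>cubic_reps g n. trop_class g n ` ({G} \<times> open_cell G)) = topspace (M_trop g n)"
    (is "_ closure_of ?U = _")
proof (intro equalityI closure_of_subset_topspace subsetI)
  fix x assume "x \<in> topspace (M_trop g n)"
  then obtain p where p: "p \<in> topspace (cells g n)" and x': "x = trop_class g n p"
    unfolding M_trop_eq topspace_quotient_topology by blast
  obtain G t where pt: "p = (G, t)"
    by (cases p)
  have G: "G \<in> cubic_reps g n" and t: "t \<in> topspace (closed_cell G)" and x: "x = trop_class g n (G, t)"
    using p x' by (simp_all add: pt mem_topspace_cells topspace_closed_cell)
  have "continuous_map (closed_cell G) (cells g n) (Pair G)"
    unfolding cells_def using G by (rule continuous_map_component_injection)
  moreover have "continuous_map (cells g n) (M_trop g n) (trop_class g n)"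
    unfolding M_trop_eq by (intro quotient_imp_continuous_map quotient_map_quotient_topology)
  ultimately have "continuous_map (closed_cell G) (M_trop g n) (trop_class g n \<circ> Pair G)"
    by (rule continuous_map_compose)
  then have "(trop_class g n \<circ> Pair G) ` (closed_cell G closure_of open_cell G)
      \<subseteq> M_trop g n closure_of ((trop_class g n \<circ> Pair G) ` open_cell G)"
    by (rule continuous_map_image_closure_subset)
  also have "\<dots> \<subseteq> M_trop g n closure_of ?U"
    using G by (intro closure_of_mono) auto
  finally show "x \<in> M_trop g n closure_of ?U"
    using t x by (auto simp: closure_of_open_cell)
qed

section \<open>Orbifold charts\<close>

text \<open>\<open>Euclidean_space d\<close> consists of the sequences that vanish from index
  \<open>d\<close> on, so this model space has the point type that \<open>orbifold\<close>
  prescribes for a chart.\<close>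

definition orthant :: "nat \<Rightarrow> (nat \<Rightarrow> real) topology" where
  "orthant d = subtopology (Euclidean_space d) {x. \<forall>i<d. 0 < x i}"

lemma topspace_orthant: "topspace (orthant d) = {x. (\<forall>i<d. 0 < x i) \<and> (\<forall>i\<ge>d. x i = 0)}"
  by (auto simp: orthant_def topspace_Euclidean_space)

lemma continuous_map_Euclidean_space_component:
  "continuous_map (Euclidean_space d) euclideanreal (\<lambda>x. x i)"
  unfolding Euclidean_space_def
  by (intro continuous_map_from_subtopology continuous_map_product_projection) simp

lemma continuous_map_orthant_component: "continuous_map (orthant d) euclideanreal (\<lambda>x. x i)"
  unfolding orthant_def
  by (intro continuous_map_from_subtopology continuous_map_Euclidean_space_component)

lemma topological_manifold_orthant: "topological_manifold d (orthant d)"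
proof -
  have "second_countable (powertop_real (UNIV :: nat set))"
  proof -
    obtain B :: "(nat \<Rightarrow> real) set set" where "countable B" "\<And>C. C \<in> B \<Longrightarrow> open C"
      and B: "\<And>S. open S \<Longrightarrow> \<exists>U. U \<subseteq> B \<and> S = \<Union>U"
      using univ_second_countable by blast
    moreover have "\<exists>V\<in>B. x \<in> V \<and> V \<subseteq> S" if "open S" "x \<in> S" for S x
      using B [OF that(1)] that(2) by blast
    ultimately show ?thesis
      unfolding euclidean_product_topology second_countable_def
      by (intro exI [of _ B]) (simp flip: open_openin)
  qed
  then have "second_countable (orthant d)"
    by (simp only: orthant_def Euclidean_space_def second_countable_subtopology)
  moreover have "Hausdorff_space (orthant d)"
    unfolding orthant_def by (intro Hausdorff_space_subtopology Hausdorff_Euclidean_space)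
  \<comment> \<open>Being open in Euclidean space, the orthant serves as a single chart around all
    its points.\<close>
  moreover have "openin (Euclidean_space d) (topspace (orthant d))"
  proof -
    have "openin (Euclidean_space d) {x \<in> topspace (Euclidean_space d). x i \<in> {0<..}}" for i
      using continuous_map_Euclidean_space_component
      by (rule openin_continuous_map_preimage) (simp flip: open_openin)
    then have "openin (Euclidean_space d)
       (topspace (Euclidean_space d) \<inter> (\<Inter>i<d. {x \<in> topspace (Euclidean_space d). x i \<in> {0<..}}))"
      by (intro openin_Int_Inter) auto
    moreover have "topspace (Euclidean_space d) \<inter> (\<Inter>i<d. {x \<in> topspace (Euclidean_space d). x i \<in> {0<..}})
       = topspace (orthant d)"
      by (auto simp: topspace_orthant topspace_Euclidean_space)
    ultimately show ?thesis
      by simp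
  qed
  moreover have "subtopology (orthant d) (topspace (orthant d)) = subtopology (Euclidean_space d) (topspace (orthant d))"
    by (simp add: orthant_def subtopology_subtopology Int_absorb1 subtopology_restrict)
  ultimately show ?thesis
    unfolding topological_manifold_def
    by (metis homeomorphic_space_refl openin_topspace)
qed

lemma homeomorphic_map_orthant_permute:
  assumes p: "p permutes {..<d}"
  shows "homeomorphic_map (orthant d) (orthant d) (\<lambda>x. x \<circ> p)"
proof -
  have cont: "continuous_map (orthant d) (orthant d) (\<lambda>x. x \<circ> q)" if q: "q permutes {..<d}" for q
  proof -
    \<comment> \<open>Since \<open>q\<close> maps the indices from \<open>d\<close> on among
      themselves, zeros stay zeros and positive entries stay positive.\<close>
    have "x \<circ> q \<in> topspace (orthant d)" if "x \<in> topspace (orthant d)" for x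
      using that permutes_in_image [OF q] by (auto simp: topspace_orthant) (metis lessThan_iff linorder_not_le)
    moreover have "continuous_map (orthant d) (powertop_real UNIV) (\<lambda>x. x \<circ> q)"
      by (auto simp: continuous_map_componentwise_UNIV continuous_map_orthant_component)
    ultimately show ?thesis
      unfolding orthant_def Euclidean_space_def subtopology_subtopology
      by (auto simp: continuous_map_in_subtopology)
  qed
  have "homeomorphic_maps (orthant d) (orthant d) (\<lambda>x. x \<circ> p) (\<lambda>x. x \<circ> inv_into UNIV p)"
    unfolding homeomorphic_maps_def
    using cont [OF p] cont [OF permutes_inv [OF p]] permutes_inv_o [OF p]
    by (simp add: o_assoc [symmetric])
  then show ?thesis
    by (rule homeomorphic_maps_imp_map)
qed

text \<open>Places coordinate \<open>i\<close> on the edge \<open>ed i\<close>; the restriction to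
  \<open>edges G\<close> makes the result extensional, as points of a cell are.\<close>

definition orthant_chart :: "('v, 'h) graph \<Rightarrow> (nat \<Rightarrow> 'h set) \<Rightarrow> nat \<Rightarrow> (nat \<Rightarrow> real) \<Rightarrow> 'h set \<Rightarrow> real" where
  "orthant_chart G ed d x = (\<lambda>e\<in>edges G. x (inv_into {..<d} ed e))"

lemma homeomorphic_map_orthant_chart:
  assumes ed: "bij_betw ed {..<d} (edges G)"
  shows "homeomorphic_map (orthant d) (subtopology (closed_cell G) (open_cell G)) (orthant_chart G ed d)"
proof -
  let ?N = "subtopology (closed_cell G) (open_cell G)"
  \<comment> \<open>The inverse of the chart reads off the lengths; the padding by 0 is what
    membership in \<open>Euclidean_space d\<close> demands from index \<open>d\<close> on.\<close>
  let ?k = "\<lambda>t i. if i < d then t (ed i) else (0::real)"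
  have top: "topspace ?N = open_cell G"
    using open_cell_subset by auto
  have edE: "ed i \<in> edges G" if "i < d" for i
    using ed that by (auto simp: bij_betw_def)
  have inv: "inv_into {..<d} ed (ed i) = i" if "i < d" for i
    using bij_betw_inv_into_left [OF ed] that by simp
  have inv': "ed (inv_into {..<d} ed e) = e" "inv_into {..<d} ed e < d" if "e \<in> edges G" for e
    using bij_betw_inv_into_right [OF ed that] bij_betw_apply [OF bij_betw_inv_into [OF ed] that] by auto
  have im: "orthant_chart G ed d x \<in> open_cell G" if "x \<in> topspace (orthant d)" for x
    using that inv' by (auto simp: orthant_chart_def open_cell_def topspace_orthant)
  have im': "?k t \<in> topspace (orthant d)" if "t \<in> open_cell G" for t
    using that edE by (fastforce simp: open_cell_def topspace_orthant)
  have "continuous_map (orthant d) (closed_cell G) (orthant_chart G ed d)"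
    unfolding closed_cell_def continuous_map_componentwise
  proof (intro conjI ballI)
    show "orthant_chart G ed d ` topspace (orthant d) \<subseteq> extensional (edges G)"
      by (auto simp: orthant_chart_def)
    fix e assume e: "e \<in> edges G"
    have "0 \<le> orthant_chart G ed d x e" if "x \<in> topspace (orthant d)" for x
      using PiE_mem [OF im [OF that, unfolded open_cell_def] e] by simp
    moreover have "continuous_map (orthant d) euclideanreal (\<lambda>x. orthant_chart G ed d x e)"
      using e continuous_map_orthant_component by (simp add: orthant_chart_def)
    ultimately show "continuous_map (orthant d) (top_of_set {0..}) (\<lambda>x. orthant_chart G ed d x e)"
      by (auto simp: continuous_map_in_subtopology)
  qed
  then have "continuous_map (orthant d) ?N (orthant_chart G ed d)"
    using im by (auto simp: continuous_map_in_subtopology)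
  moreover have "continuous_map ?N (orthant d) ?k"
  proof -
    have "continuous_map (closed_cell G) euclideanreal (\<lambda>t. t (ed i))" if "i < d" for i
      using continuous_map_product_projection [OF edE [OF that], of "\<lambda>_. top_of_set {0::real..}"]
      by (simp add: closed_cell_def continuous_map_in_subtopology)
    then have "continuous_map ?N (Euclidean_space d) ?k"
      by (auto simp: continuous_map_componentwise_Euclidean_space intro: continuous_map_from_subtopology)
    then show ?thesis
      using im' top unfolding orthant_def
      by (auto simp: continuous_map_in_subtopology topspace_orthant)
  qed
  moreover have "?k (orthant_chart G ed d x) = x" if "x \<in> topspace (orthant d)" for x
    using that edE inv by (auto simp: orthant_chart_def topspace_orthant)
  moreover have "orthant_chart G ed d (?k t) = t" if "t \<in> open_cell G" for t
    using that inv' by (auto simp: orthant_chart_def open_cell_def extensional_def PiE_def)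
  ultimately have "homeomorphic_maps (orthant d) ?N (orthant_chart G ed d) ?k"
    unfolding homeomorphic_maps_def top by blast
  then show ?thesis
    by (rule homeomorphic_maps_imp_map)
qed

text \<open>The chart is a homeomorphism onto the open cell, and a quotient map restricted to the
  full preimage of an open set is again a quotient map.\<close>

lemma quotient_map_orthant_M_trop:
  assumes G: "G \<in> cubic_reps g n" and ed: "bij_betw ed {..<d} (edges G)"
  shows "quotient_map (orthant d) (subtopology (M_trop g n) (trop_class g n ` ({G} \<times> open_cell G)))
    (\<lambda>x. trop_class g n (G, orthant_chart G ed d x))"
proof -
  let ?W = "{G} \<times> open_cell G"
  have "homeomorphic_map (closed_cell G) (subtopology (cells g n) (Pair G ` topspace (closed_cell G))) (Pair G)"
    using embedding_map_component_injection [of G _ closed_cell] G unfolding cells_def embedding_map_def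
    by blast
  then have "homeomorphic_map (subtopology (closed_cell G) (open_cell G))
     (subtopology (subtopology (cells g n) (Pair G ` topspace (closed_cell G))) ?W) (Pair G)"
    by (rule homeomorphic_map_subtopologies_alt) auto
  moreover have "Pair G ` topspace (closed_cell G) \<inter> ?W = ?W"
    using open_cell_subset [of G] by blast
  ultimately have "homeomorphic_map (subtopology (closed_cell G) (open_cell G))
     (subtopology (cells g n) ?W) (Pair G)"
    by (simp add: subtopology_subtopology)
  then have 1: "homeomorphic_map (orthant d) (subtopology (cells g n) ?W) (Pair G \<circ> orthant_chart G ed d)"
    using homeomorphic_map_orthant_chart [OF ed] homeomorphic_map_compose by blast
  have "{p \<in> topspace (cells g n). trop_class g n p \<in> trop_class g n ` ?W} = ?W"
    using trop_class_mem_open_cell [OF _ G] openin_subset [OF openin_cells_open_cell [OF G]] by blast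
  then have 2: "quotient_map (subtopology (cells g n) ?W) (subtopology (M_trop g n) (trop_class g n ` ?W))
      (trop_class g n)"
    using openin_M_trop_open_cell [OF G] unfolding M_trop_eq
    by (intro quotient_map_restriction quotient_map_quotient_topology) auto
  show ?thesis
    using quotient_map_compose [OF conjunct1 [OF 1 [unfolded homeomorphic_map_def]] 2] by (simp add: o_def)
qed

section \<open>Automorphisms acting on the coordinates\<close>

text \<open>The image of the automorphism group in the symmetric group on edge indices. The passage
  can lose information: exchanging the two half-edges of a loop, for instance, contributes the
  identity.\<close>

definition edge_perms :: "('v, 'h) graph \<Rightarrow> (nat \<Rightarrow> 'h set) \<Rightarrow> nat \<Rightarrow> (nat \<Rightarrow> nat) set" where
  "edge_perms G ed d = {p. p permutes {..<d} \<and>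
     (\<exists>\<phi> \<psi>. graph_iso_via G G \<phi> \<psi> \<and> (\<forall>i<d. ed (p i) = \<psi> ` ed i))}"

lemma edge_perms_id: "id \<in> edge_perms G ed d"
  unfolding edge_perms_def using permutes_id graph_iso_via_id [of G] by fastforce

lemma edge_perms_comp:
  assumes "involutive_graph G" "p \<in> edge_perms G ed d" "q \<in> edge_perms G ed d"
  shows "p \<circ> q \<in> edge_perms G ed d"
proof -
  obtain \<phi> \<psi> \<phi>' \<psi>' where p: "p permutes {..<d}" "graph_iso_via G G \<phi> \<psi>" "\<forall>i<d. ed (p i) = \<psi> ` ed i"
    and q: "q permutes {..<d}" "graph_iso_via G G \<phi>' \<psi>'" "\<forall>i<d. ed (q i) = \<psi>' ` ed i"
    using assms by (auto simp: edge_perms_def)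
  have "\<forall>i<d. ed ((p \<circ> q) i) = (\<psi> \<circ> \<psi>') ` ed i"
    using p(3) q(3) permutes_in_image [OF q(1)] by (simp flip: image_image)
  then show ?thesis
    unfolding edge_perms_def
    using graph_iso_via_comp [OF q(2) p(2) assms(1)] permutes_compose [OF q(1) p(1)] by blast
qed

lemma edge_perms_inv:
  assumes G: "involutive_graph G" and ed: "bij_betw ed {..<d} (edges G)" and p: "p \<in> edge_perms G ed d"
  shows "inv_into UNIV p \<in> edge_perms G ed d"
proof -
  obtain \<phi> \<psi> where p: "p permutes {..<d}" "graph_iso_via G G \<phi> \<psi>" "\<forall>i<d. ed (p i) = \<psi> ` ed i"
    using p by (auto simp: edge_perms_def)
  have "ed (inv_into UNIV p i) = inv_into (halves G) \<psi> ` ed i" if "i < d" for i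
  proof -
    have j: "inv_into UNIV p i < d" "p (inv_into UNIV p i) = i"
      using that permutes_in_image [OF permutes_inv [OF p(1)]] permutes_inverses(1) [OF p(1)] by auto
    then have "ed (inv_into UNIV p i) \<subseteq> halves G"
      using edges_subset_halves [OF G] ed by (auto simp: bij_betw_def)
    then have "inv_into (halves G) \<psi> ` \<psi> ` ed (inv_into UNIV p i) = ed (inv_into UNIV p i)"
      using graph_iso_viaD(2) [OF p(2)] by (simp add: bij_betw_def)
    then show ?thesis
      using p(3) j by metis
  qed
  then show ?thesis
    unfolding edge_perms_def
    using permutes_inv [OF p(1)] graph_iso_via_inv [OF p(2) G] by blast
qed

text \<open>All lengths are positive, so identification means a length-preserving automorphism. In
  indices, the condition that \<open>?t\<close> at the image of an edge equals \<open>?s\<close> at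
  the edge reads \<open>y (p i) = x i\<close>, so no inverse of \<open>p\<close> appears.\<close>

lemma trop_class_orthant_chart_eq_iff:
  assumes G: "G \<in> cubic_reps g n" and ed: "bij_betw ed {..<d} (edges G)"
    and x: "x \<in> topspace (orthant d)" and y: "y \<in> topspace (orthant d)"
  shows "trop_class g n (G, orthant_chart G ed d x) = trop_class g n (G, orthant_chart G ed d y) \<longleftrightarrow>
    (\<exists>p\<in>edge_perms G ed d. x = y \<circ> p)"
proof -
  note inv = cubic_repsD(1) [OF G]
  let ?s = "orthant_chart G ed d x" and ?t = "orthant_chart G ed d y"
  have edE: "ed i \<in> edges G" if "i < d" for i
    using ed that by (auto simp: bij_betw_def)
  have val: "orthant_chart G ed d z (ed i) = z i" if "i < d" for z i
    using bij_betw_inv_into_left [OF ed] that edE by (simp add: orthant_chart_def)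
  have E: "edges G = ed ` {..<d}"
    using ed by (simp add: bij_betw_def)
  have cell: "?s \<in> open_cell G" "?t \<in> open_cell G"
    using homeomorphic_imp_surjective_map [OF homeomorphic_map_orthant_chart [OF ed]] x y by auto
  then have "trop_class g n (G, ?s) = trop_class g n (G, ?t) \<longleftrightarrow> same_point (G, ?s) (G, ?t)"
    using open_cell_subset [of G] G
    by (intro trop_class_eq_iff) (auto simp: mem_topspace_cells topspace_closed_cell)
  also have "\<dots> \<longleftrightarrow> (\<exists>\<phi> \<psi>. graph_iso_via G G \<phi> \<psi> \<and> (\<forall>e\<in>edges G. ?t (\<psi> ` e) = ?s e))"
    using open_cell_pos [OF cell(1)] open_cell_pos [OF cell(2)] inv
    by (intro same_point_nonzero_iff) fastforce+
  also have "\<dots> \<longleftrightarrow> (\<exists>p\<in>edge_perms G ed d. x = y \<circ> p)"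
  proof
    assume "\<exists>\<phi> \<psi>. graph_iso_via G G \<phi> \<psi> \<and> (\<forall>e\<in>edges G. ?t (\<psi> ` e) = ?s e)"
    then obtain \<phi> \<psi> where iso: "graph_iso_via G G \<phi> \<psi>" and l: "\<forall>e\<in>edges G. ?t (\<psi> ` e) = ?s e"
      by blast
    \<comment> \<open>The edge map of the automorphism, conjugated by the enumeration
      \<open>ed\<close>; off \<open>{..<d}\<close> it has to be the identity for
      \<open>permutes\<close>.\<close>
    define p where "p i = (if i < d then inv_into {..<d} ed (\<psi> ` ed i) else i)" for i
    have "bij_betw (inv_into {..<d} ed \<circ> ((`) \<psi> \<circ> ed)) {..<d} {..<d}"
      using graph_iso_via_edges [OF iso inv] bij_betw_inv_into [OF ed] ed by (blast intro: bij_betw_trans)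
    then have "bij_betw p {..<d} {..<d}"
      by (rule bij_betw_cong [THEN iffD1, rotated]) (simp add: p_def)
    then have p: "p permutes {..<d}"
      by (rule bij_imp_permutes) (simp add: p_def)
    have edp: "ed (p i) = \<psi> ` ed i" "p i < d" if "i < d" for i
    proof -
      have "\<psi> ` ed i \<in> edges G"
        using graph_iso_via_edges [OF iso inv] edE [OF that] bij_betw_apply by fast
      then show "ed (p i) = \<psi> ` ed i"
        using bij_betw_inv_into_right [OF ed] that by (simp add: p_def)
      show "p i < d"
        using permutes_in_image [OF p] that by simp
    qed
    have "x i = (y \<circ> p) i" for i
    proof (cases "i < d")
      case True
      then have "?t (ed (p i)) = ?s (ed i)"
        using l edE edp by simp
      then show ?thesis
        using val [OF True] val [OF edp(2) [OF True]] by simp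
    next
      \<comment> \<open>Here \<open>p i = i\<close>, and both sequences vanish from \<open>d\<close>
        on.\<close>
      case False
      then show ?thesis
        using x y by (simp add: topspace_orthant p_def)
    qed
    then show "\<exists>p\<in>edge_perms G ed d. x = y \<circ> p"
      using p iso edp(1) unfolding edge_perms_def by blast
  next
    assume "\<exists>p\<in>edge_perms G ed d. x = y \<circ> p"
    then obtain p \<phi> \<psi> where p: "p permutes {..<d}" "graph_iso_via G G \<phi> \<psi>"
      "\<forall>i<d. ed (p i) = \<psi> ` ed i" and xy: "x = y \<circ> p"
      by (auto simp: edge_perms_def)
    have "?t (\<psi> ` ed i) = ?s (ed i)" if "i < d" for i
    proof -
      have "p i < d"
        using permutes_in_image [OF p(1)] that by simp
      then show ?thesis
        using p(3) that val xy by (metis comp_apply)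
    qed
    then show "\<exists>\<phi> \<psi>. graph_iso_via G G \<phi> \<psi> \<and> (\<forall>e\<in>edges G. ?t (\<psi> ` e) = ?s e)"
      using p(2) unfolding E by blast
  qed
  finally show ?thesis .
qed

text \<open>Precomposition reverses products, so sending \<open>p\<close> to
  \<open>x \<circ> p\<close> is an anti-homomorphism. The image of a set closed under products and
  inverses is a subgroup all the same, and the orbits depend on this image only. The maps are
  restricted to \<open>E\<close> because \<open>Bij E\<close> consists of extensional
  functions.\<close>

lemma subgroup_permute_orthant:
  fixes d
  defines "E \<equiv> topspace (orthant d)"
  assumes perm: "\<And>p. p \<in> P \<Longrightarrow> p permutes {..<d}" and id: "id \<in> P"
    and comp: "\<And>p q. \<lbrakk>p \<in> P; q \<in> P\<rbrakk> \<Longrightarrow> p \<circ> q \<in> P" and inv: "\<And>p. p \<in> P \<Longrightarrow> inv_into UNIV p \<in> P"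
  shows "subgroup ((\<lambda>p. \<lambda>x\<in>E. x \<circ> p) ` P) (BijGroup E)"
proof -
  interpret B: group "BijGroup E"
    by (rule group_BijGroup)
  let ?a = "\<lambda>p. \<lambda>x\<in>E. x \<circ> p"
  have closed: "x \<circ> p \<in> E" if "p \<in> P" "x \<in> E" for p x
    using homeomorphic_imp_surjective_map [OF homeomorphic_map_orthant_permute [OF perm [OF that(1)]]] that(2)
    unfolding E_def by blast
  have bij: "?a p \<in> Bij E" if "p \<in> P" for p
  proof -
    have "bij_betw (\<lambda>x. x \<circ> p) E E"
      using homeomorphic_map_orthant_permute [OF perm [OF that]]
      unfolding E_def bij_betw_def homeomorphic_eq_everything_map by blast
    then have "bij_betw (?a p) E E"
      by (rule bij_betw_cong [THEN iffD1, rotated]) simp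
    then show ?thesis
      by (simp add: Bij_def)
  qed
  have mult: "?a p \<otimes>\<^bsub>BijGroup E\<^esub> ?a q = ?a (q \<circ> p)" if "p \<in> P" "q \<in> P" for p q
    using bij [OF that(1)] bij [OF that(2)] closed [OF that(2)]
    by (auto simp: BijGroup_def compose_def o_assoc)
  have one: "\<one>\<^bsub>BijGroup E\<^esub> = ?a id"
    by (simp add: BijGroup_def)
  show ?thesis
  proof (rule B.subgroupI)
    show "?a ` P \<subseteq> carrier (BijGroup E)"
      using bij by (auto simp: BijGroup_def)
    show "?a ` P \<noteq> {}"
      using id by blast
  next
    fix a assume "a \<in> ?a ` P"
    then obtain p where p: "p \<in> P" "a = ?a p" by blast
    have "?a (inv_into UNIV p) \<otimes>\<^bsub>BijGroup E\<^esub> a = \<one>\<^bsub>BijGroup E\<^esub>"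
      unfolding p(2) mult [OF inv [OF p(1)] p(1)] one permutes_inv_o(1) [OF perm [OF p(1)]] ..
    then have "inv\<^bsub>BijGroup E\<^esub> a = ?a (inv_into UNIV p)"
      using bij p inv by (intro B.inv_equality) (auto simp: BijGroup_def)
    then show "inv\<^bsub>BijGroup E\<^esub> a \<in> ?a ` P"
      using inv [OF p(1)] by blast
  next
    fix a b assume "a \<in> ?a ` P" "b \<in> ?a ` P"
    then show "a \<otimes>\<^bsub>BijGroup E\<^esub> b \<in> ?a ` P"
      using mult comp by blast
  qed
qed

text \<open>The orbits of \<open>K\<close> are exactly the sets of points of the orthant that
  \<open>trop_class\<close> identifies, so both spaces are quotients by one relation.\<close>

lemma open_cell_orbifold_chart:
  assumes G: "G \<in> cubic_reps g n" and d: "d = card (edges G)"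
  shows "\<exists>(M :: (nat \<Rightarrow> real) topology) (K :: nat monoid) \<alpha>.
    topological_manifold d M \<and> finite (carrier K) \<and> group_action K (topspace M) \<alpha> \<and>
    (\<forall>a\<in>carrier K. homeomorphic_map M M (\<alpha> a)) \<and>
    subtopology (M_trop g n) (trop_class g n ` ({G} \<times> open_cell G)) homeomorphic_space
      quotient_topology M (orbit K \<alpha>)"
proof -
  note inv = cubic_repsD(1) [OF G]
  obtain ed where ed: "bij_betw ed {..<d} (edges G)"
    using ex_bij_betw_nat_finite [OF cubic_repsD(2) [OF G]] d by (auto simp: atLeast0LessThan)
  define P where "P = edge_perms G ed d"
  have perm: "p permutes {..<d}" if "p \<in> P" for p
    using that by (simp add: P_def edge_perms_def)
  let ?E = "topspace (orthant d)"
  define A where "A p = (\<lambda>x\<in>?E. x \<circ> p)" for p :: "nat \<Rightarrow> nat"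
  have "subgroup (A ` P) (BijGroup ?E)"
    unfolding A_def P_def
    using edge_perms_id edge_perms_comp [OF inv] edge_perms_inv [OF inv ed] perm
    by (intro subgroup_permute_orthant) (auto simp: P_def)
  moreover have "finite (A ` P)"
    using perm finite_subset [OF _ finite_permutations [of "{..<d}"]] by (intro finite_imageI) blast
  ultimately obtain K :: "nat monoid" and \<alpha> where K: "finite (carrier K)" "group_action K ?E \<alpha>"
    and im: "\<alpha> ` carrier K = A ` P"
    by (rule finite_bijection_group_nat)
  have hom: "homeomorphic_map (orthant d) (orthant d) (\<alpha> a)" if "a \<in> carrier K" for a
  proof -
    have "\<alpha> a \<in> A ` P"
      using that unfolding im [symmetric] by (rule imageI)
    then obtain p where p: "p \<in> P" "\<alpha> a = A p"
      by blast
    show ?thesis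
      unfolding p(2) A_def
      by (rule homeomorphic_map_eq [OF homeomorphic_map_orthant_permute [OF perm [OF p(1)]]]) simp
  qed
  \<comment> \<open>An orbit sees only the set of bijections that \<alpha> takes as values, so the
    enumeration behind \<open>K\<close> drops out.\<close>
  have orb: "orbit K \<alpha> y = (\<lambda>p. y \<circ> p) ` P" if "y \<in> ?E" for y
  proof -
    have "orbit K \<alpha> y = (\<lambda>f. f y) ` (\<alpha> ` carrier K)"
      by (auto simp: orbit_def)
    also have "\<dots> = (\<lambda>p. y \<circ> p) ` P"
      unfolding im using that by (auto simp: A_def image_image)
    finally show ?thesis .
  qed
  have orb_eq: "orbit K \<alpha> x = orbit K \<alpha> y \<longleftrightarrow> x \<in> orbit K \<alpha> y" if "x \<in> ?E" "y \<in> ?E" for x y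
    using that group_action.orbit_refl [OF K(2)] group_action.orbit_sym [OF K(2)]
      group_action.orbit_trans [OF K(2)] group_action.element_image [OF K(2)]
    unfolding orbit_def by (smt (verit) Collect_cong mem_Collect_eq)
  have "subtopology (M_trop g n) (trop_class g n ` ({G} \<times> open_cell G)) homeomorphic_space
      quotient_topology (orthant d) (orbit K \<alpha>)"
  proof (rule quotient_maps_same_kernel_homeomorphic_space
      [OF quotient_map_orthant_M_trop [OF G ed] quotient_map_quotient_topology])
    fix x y assume xy: "x \<in> ?E" "y \<in> ?E"
    show "trop_class g n (G, orthant_chart G ed d x) = trop_class g n (G, orthant_chart G ed d y) \<longleftrightarrow>
      orbit K \<alpha> x = orbit K \<alpha> y"
      unfolding trop_class_orthant_chart_eq_iff [OF G ed xy] orb_eq [OF xy]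
      unfolding orb [OF xy(2)] P_def by blast
  qed
  then show ?thesis
    using topological_manifold_orthant K hom by blast
qed

theorem mainTheorem4:
  fixes g n :: nat
  assumes "2 * int g - 2 + int n \<ge> 1"
  shows "has_pure_dimension (M_trop g n) (nat (3 * int g - 3 + int n))"
proof -
  let ?d = "nat (3 * int g - 3 + int n)" and ?V = "\<lambda>G. trop_class g n ` ({G} \<times> open_cell G)"
  let ?U = "\<Union>G\<in>cubic_reps g n. ?V G"
  have "openin (M_trop g n) ?U"
    using openin_M_trop_open_cell by blast
  moreover have "M_trop g n closure_of ?U = topspace (M_trop g n)"
    by (rule M_trop_closure_of_open_cells)
  moreover have "orbifold ?d (subtopology (M_trop g n) ?U)"
    unfolding orbifold_def
  proof
    fix x assume "x \<in> topspace (subtopology (M_trop g n) ?U)"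
    then obtain G where G: "G \<in> cubic_reps g n" and x: "x \<in> ?V G"
      by auto
    have "openin (subtopology (M_trop g n) ?U) (?V G)"
      using openin_M_trop_open_cell [OF G] G by (intro openin_subtopology [THEN iffD2] exI [of _ "?V G"]) blast
    moreover have "subtopology (subtopology (M_trop g n) ?U) (?V G) = subtopology (M_trop g n) (?V G)"
    proof -
      have "?U \<inter> ?V G = ?V G"
        using G by blast
      then show ?thesis
        by (simp only: subtopology_subtopology)
    qed
    ultimately show "\<exists>U. openin (subtopology (M_trop g n) ?U) U \<and> x \<in> U \<and>
        (\<exists>(M :: (nat \<Rightarrow> real) topology) (K :: nat monoid) \<alpha>.
           topological_manifold ?d M \<and> finite (carrier K) \<and> group_action K (topspace M) \<alpha> \<and>
           (\<forall>a\<in>carrier K. homeomorphic_map M M (\<alpha> a)) \<and>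
           subtopology (subtopology (M_trop g n) ?U) U homeomorphic_space quotient_topology M (orbit K \<alpha>))"
      \<comment> \<open>The edge count does not depend on the representative, so all charts have the
        same dimension \<open>?d\<close>.\<close>
      using open_cell_orbifold_chart [OF G cubic_repsD(3) [OF G, symmetric]] x by (intro exI [of _ "?V G"]) simp
  qed
  ultimately show ?thesis
    unfolding has_pure_dimension_def by blast
qed

end
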